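(* Let $d\ge 1$ be an integer (the spatial dimension) and let $\alpha>0$ be a real number. For each $k\in\{\tfrac12,1,\tfrac32,2,\dots\}$ let $\ell=\ell(k)=\lfloor \tfrac d2+k\rfloor+1$ and let $\psi_{\ell,k}:[0,\infty)\to\mathbb{R}$ be the normalised equal area Wendland function with parameter $\alpha$. Then $$\lim_{k\to\infty}\psi_{\ell,k}(y)=e^{-\alpha y^2},$$ with uniform convergence for $y\in\mathbb{R}^+=[0,\infty)$, where $k\to\infty$ through all positive integer and half-integer values.
   Context: Let $d\ge1$ be an integer. For $2k$ a positive integer and $\ell=\lfloor \tfrac d2+k\rfloor+1$ (with $\lfloor\cdot\rfloor$ the floor function), the Wendland function $\phi_{\ell,k}:[0,\infty)\to\mathbb{R}$ is $$\phi_{\ell,k}(r)=\frac{1}{\Gamma(k)\,2^{k-1}}\int_r^1 s(1-s)^{\ell}(s^2-r^2)^{k-1}\,\mathrm{d}s\quad (0\le r\le 1),\qquad \phi_{\ell,k}(r)=0\quad (r>1).$$ For $\alpha>0$ set $$\delta_{\ell,k}(\alpha)=\frac{(\ell+2k+1)\,\Gamma(k+\frac12)}{2\sqrt{\alpha}\,\Gamma(k+1)}.$$ The normalised equal area Wendland function with parameter $\alpha$ is $$\psi_{\ell,k}(y)=\frac{2^{k-1}\Gamma(k)\Gamma(\ell+2k+1)}{\Gamma(\ell+1)\Gamma(2k)}\,\phi_{\ell,k}\!\left(\frac{y}{\delta_{\ell,k}(\alpha)}\right)\quad\text{for }0\le y\le\delta_{\ell,k}(\alpha),\qquad \psi_{\ell,k}(y)=0\quad\text{for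 }y>\delta_{\ell,k}(\alpha).$$ *)

theory Defs
  imports "HOL-Analysis.Analysis"
begin

definition wendland_ell :: "nat \<Rightarrow> real \<Rightarrow> nat" where
  "wendland_ell d k = nat \<lfloor>real d / 2 + k\<rfloor> + 1"

text \<open>The functions below are only meant for nonnegative argument and \<open>k > 0\<close>.
  On the interval of integration \<open>s\<^sup>2 - r\<^sup>2 \<ge> 0\<close>, so \<open>powr\<close> is the usual real power except
  at the single point \<open>s = r\<close>, where \<open>0 powr a = 0\<close>; this does not affect the integral.
  For \<open>k < 1\<close> the integrand has an integrable singularity at \<open>s = r\<close>.\<close>

definition wendland_phi :: "nat \<Rightarrow> real \<Rightarrow> real \<Rightarrow> real" where
  "wendland_phi l k r =
     (if r \<le> 1
      then 1 / (Gamma k * 2 powr (k - 1)) *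
           integral {r..1} (\<lambda>s. s * (1 - s) ^ l * (s\<^sup>2 - r\<^sup>2) powr (k - 1))
      else 0)"

definition wendland_delta :: "nat \<Rightarrow> real \<Rightarrow> real \<Rightarrow> real" where
  "wendland_delta l k \<alpha> =
     (real l + 2 * k + 1) * Gamma (k + 1/2) / (2 * sqrt \<alpha> * Gamma (k + 1))"

definition wendland_psi :: "nat \<Rightarrow> real \<Rightarrow> real \<Rightarrow> real \<Rightarrow> real" where
  "wendland_psi l k \<alpha> y =
     (if y \<le> wendland_delta l k \<alpha>
      then 2 powr (k - 1) * Gamma k * Gamma (real l + 2 * k + 1)
             / (Gamma (real l + 1) * Gamma (2 * k))
           * wendland_phi l k (y / wendland_delta l k \<alpha>)
      else 0)"

end

(* Substituting s^2 - r^2 = s^2 (1 - r^2/s^2) turns psi(y) into the mean of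
   max(0, 1 - r^2/S^2)^(k-1), r = y/delta, for S with the Beta distribution with parameters 2k and
   l + 1. Now (1 - t)^(k-1) is within 2/(k-1) of exp(-(k-1)t), and with c = (k-1)/(delta^2 alpha)
   the exponential at t = r^2/S^2 is exp(-alpha y^2 c/S^2), which differs from exp(-alpha y^2) by
   at most |S^2/c - 1|, uniformly in y. By log-convexity of Gamma, c tends to 4/9, which is also the
   limit of the mean of S^2, and S^2 concentrates there: its first two moments are explicit rational
   functions of k and l, so the mean of (S^2/c - 1)^2 tends to 0. *)

theory Submission
  imports Defs
begin

section \<open>Elementary inequalities for powers and exponentials\<close>

text \<open>Weighted AM-GM for \<open>a\<close> and 1 with weights \<open>t\<close> and
  \<open>1 - t\<close>.\<close>

lemma powr_le_affine:
  fixes a t :: real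
  assumes "0 < a" "0 \<le> t" "t \<le> 1"
  shows "a powr t \<le> 1 - t + t * a"
  using Youngs_inequality_0[of t "1 - t" a 1] assms by simp

text \<open>Bernoulli's inequality for real exponents: the affine bound with exponent
  \<open>1 / p\<close>, applied to \<open>u powr p\<close> and multiplied by
  \<open>p\<close>.\<close>

lemma powr_ge_affine:
  fixes u p :: real
  assumes "0 \<le> u" "1 \<le> p"
  shows "1 - p + p * u \<le> u powr p"
proof (cases "u = 0")
  case False
  have "u \<le> 1 - 1 / p + 1 / p * u powr p"
    using powr_le_affine[of "u powr p" "1 / p"] assms False by (simp add: powr_powr)
  then have "p * u \<le> p * (1 - 1 / p + 1 / p * u powr p)"
    using assms by (intro mult_left_mono) auto
  also have "\<dots> = p - 1 + u powr p"
    using assms by (simp add: field_simps)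
  finally show ?thesis by simp
qed (use assms in simp)

text \<open>The affine bound for \<open>exp (- w)\<close> with exponent \<open>t\<close>. The result
  does not involve \<open>w\<close>, which is the source of the uniformity in \<open>y\<close> later
  on.\<close>

lemma exp_minus_scaled_diff_le:
  fixes t w :: real
  assumes "0 \<le> t" "t \<le> 1"
  shows "exp (- (t * w)) - exp (- w) \<le> 1 - t"
proof -
  have "exp (- (t * w)) \<le> 1 - t + t * exp (- w)"
    using powr_le_affine[of "exp (- w)" t] assms by (simp add: powr_def)
  moreover have "t * exp (- w) \<le> exp (- w)"
    using assms by (simp add: mult_left_le_one_le)
  ultimately show ?thesis by linarith
qed

text \<open>Whichever of \<open>x\<close> and \<open>1 / x\<close> is at most 1 serves as the
  scaling factor \<open>t\<close> of the previous estimate, so \<open>v\<close> drops out of the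
  bound.\<close>

lemma abs_exp_minus_divide_diff_le:
  fixes v x :: real
  assumes "0 \<le> v" "0 < x"
  shows "\<bar>exp (- (v / x)) - exp (- v)\<bar> \<le> \<bar>x - 1\<bar>"
proof (cases "x \<le> 1")
  case True
  have "v \<le> v / x"
    using True assms by (simp add: field_simps mult_left_le)
  moreover have "exp (- v) - exp (- (v / x)) \<le> 1 - x"
    using exp_minus_scaled_diff_le[of x "v / x"] True assms by simp
  ultimately show ?thesis using True by simp
next
  case False
  have "v / x \<le> v"
    using False assms mult_left_mono[of 1 x v] by (simp add: field_simps)
  moreover have "exp (- (v / x)) - exp (- v) \<le> 1 - 1 / x"
    using exp_minus_scaled_diff_le[of "1 / x" v] False by simp
  \<comment> \<open>This is \<open>x + 1 / x \<ge> 2\<close>, that is,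
    \<open>(x - 1)^2 \<ge> 0\<close> divided by \<open>x\<close>.\<close>
  moreover have "1 - 1 / x \<le> x - 1"
    using False zero_le_power2[of "x - 1"] by (simp add: field_simps power2_eq_square)
  ultimately show ?thesis using False by simp
qed

text \<open>The upper half is \<open>1 - t \<le> exp (- t)\<close>. For the lower half, Bernoulli
  bounds \<open>(1 - t^2) powr p\<close> below by \<open>1 - p * t^2\<close>, while its factor
  \<open>(1 + t) powr p\<close> is at most \<open>exp (p * t)\<close>. The loss is
  \<open>p * t^2 * exp (- (p * t))\<close>.\<close>

lemma abs_powr_minus_exp_le:
  fixes p t :: real
  assumes "1 \<le> p" "0 \<le> t"
  shows "\<bar>max 0 (1 - t) powr p - exp (- (p * t))\<bar> \<le> 2 / p"
proof -
  have upper: "max 0 (1 - t) powr p \<le> exp (- (p * t))"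
  proof (cases "t < 1")
    case True
    have "(1 - t) powr p \<le> exp (- t) powr p"
      using True assms exp_ge_add_one_self[of "- t"] by (intro powr_mono2) auto
    then show ?thesis using True by (simp add: powr_def)
  qed (use assms in simp)
  have lower: "(1 - p * t\<^sup>2) * exp (- (p * t)) \<le> max 0 (1 - t) powr p"
  proof (cases "t < 1")
    case True
    have t2: "t\<^sup>2 \<le> 1" using True assms by (simp add: abs_square_le_1)
    have "1 - p * t\<^sup>2 \<le> (1 - t\<^sup>2) powr p"
      using powr_ge_affine[of "1 - t\<^sup>2" p] t2 assms by (simp add: algebra_simps)
    also have "\<dots> = (1 - t) powr p * (1 + t) powr p"
      using True assms by (simp add: powr_mult[symmetric] power2_eq_square algebra_simps)
    also have "\<dots> \<le> (1 - t) powr p * exp t powr p"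
      using assms exp_ge_add_one_self[of t] by (intro mult_left_mono powr_mono2) auto
    finally have "(1 - p * t\<^sup>2) * exp (- (p * t)) \<le> (1 - t) powr p * exp (p * t) * exp (- (p * t))"
      by (intro mult_right_mono) (simp_all add: powr_def)
    then show ?thesis using True by (simp add: mult.assoc flip: exp_add)
  next
    case False
    \<comment> \<open>Beyond \<open>t = 1\<close> the truncated power is 0, and the lower bound has
      become nonpositive.\<close>
    have "1 \<le> p * t\<^sup>2"
      using mult_mono[of 1 p 1 "t\<^sup>2"] False assms by simp
    then have "(1 - p * t\<^sup>2) * exp (- (p * t)) \<le> 0"
      by (intro mult_nonpos_nonneg) auto
    then show ?thesis using False by simp
  qed
  \<comment> \<open>With \<open>x = p * t\<close> the loss is \<open>x^2 * exp (- x) / p\<close>,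
    and \<open>x^2 / 2 \<le> exp x\<close> bounds it by \<open>2 / p\<close> for every
    \<open>t\<close>.\<close>
  have "(p * t)\<^sup>2 / 2 \<le> exp (p * t)"
    using exp_lower_Taylor_quadratic[of "p * t"] mult_nonneg_nonneg[of p t] assms by linarith
  then have "(p * t)\<^sup>2 * exp (- (p * t)) \<le> 2"
    by (simp add: exp_minus field_simps)
  then have "p * t\<^sup>2 * exp (- (p * t)) \<le> 2 / p"
    using assms by (simp add: field_simps power2_eq_square)
  with upper lower show ?thesis
    by (simp add: algebra_simps)
qed

section \<open>Gamma ratios and Beta integrals\<close>

lemma Gamma_midpoint_le:
  fixes x y :: real
  assumes "0 < x" "0 < y"
  shows "(Gamma ((x + y) / 2))\<^sup>2 \<le> Gamma x * Gamma y"
proof -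
  have pos: "0 < Gamma x" "0 < Gamma y" "0 < Gamma ((x + y) / 2)"
    using assms by (auto intro: Gamma_real_pos)
  have "ln (Gamma ((x + y) / 2)) \<le> (ln (Gamma x) + ln (Gamma y)) / 2"
    using convex_onD[OF log_convex_Gamma_real, of "1/2" x y] assms
    by (simp add: field_simps)
  then have "ln ((Gamma ((x + y) / 2))\<^sup>2) \<le> ln (Gamma x * Gamma y)"
    using pos by (simp add: ln_mult ln_realpow)
  then show ?thesis using pos by simp
qed

text \<open>Midpoint log-convexity on \<open>[k, k + 1]\<close> and on
  \<open>[k + 1/2, k + 3/2]\<close>, each combined with the functional equation. The ratio is the
  reciprocal of the Gamma quotient in \<open>wendland_delta\<close>, so the bounds fix the growth of
  that scale.\<close>

lemma Gamma_half_ratio_bounds: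
  fixes k :: real
  assumes "0 < k"
  shows "k \<le> (Gamma (k + 1) / Gamma (k + 1/2))\<^sup>2"
    and "(Gamma (k + 1) / Gamma (k + 1/2))\<^sup>2 \<le> k + 1/2"
proof -
  have pos: "0 < Gamma k" "0 < Gamma (k + 1)" "0 < Gamma (k + 1/2)"
    using assms by (auto intro: Gamma_real_pos)
  have rec: "Gamma (k + 1) = k * Gamma k"
    using assms by (intro Gamma_plus1) (auto elim!: nonpos_Ints_cases)
  have "k + 1/2 \<notin> \<int>\<^sub>\<le>\<^sub>0"
    using assms by (auto elim!: nonpos_Ints_cases)
  then have rec': "Gamma (k + 3/2) = (k + 1/2) * Gamma (k + 1/2)"
    using Gamma_plus1[of "k + 1/2"] by (simp add: add.assoc)
  have "(Gamma (k + 1/2))\<^sup>2 \<le> Gamma k * Gamma (k + 1)"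
    using Gamma_midpoint_le[of k "k + 1"] assms by (simp add: field_simps)
  then have "k * (Gamma (k + 1/2))\<^sup>2 \<le> k * (Gamma k * Gamma (k + 1))"
    using assms by (intro mult_left_mono) auto
  also have "\<dots> = (Gamma (k + 1))\<^sup>2"
    by (simp add: rec power2_eq_square)
  finally have "k * (Gamma (k + 1/2))\<^sup>2 \<le> (Gamma (k + 1))\<^sup>2" .
  then show "k \<le> (Gamma (k + 1) / Gamma (k + 1/2))\<^sup>2"
    using pos by (simp add: power_divide field_simps)
  have mid: "(k + 1/2 + (k + 3/2)) / 2 = k + 1" by simp
  have "(Gamma (k + 1))\<^sup>2 \<le> Gamma (k + 1/2) * Gamma (k + 3/2)"
    using Gamma_midpoint_le[of "k + 1/2" "k + 3/2", unfolded mid] assms by simp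
  also have "\<dots> = (k + 1/2) * (Gamma (k + 1/2))\<^sup>2"
    unfolding rec' by (simp only: power2_eq_square mult_ac)
  finally show "(Gamma (k + 1) / Gamma (k + 1/2))\<^sup>2 \<le> k + 1/2"
    using pos by (simp only: power_divide pos_divide_le_eq zero_less_power)
qed

lemma Beta_real_pos: "0 < a \<Longrightarrow> 0 < b \<Longrightarrow> 0 < Beta a (b :: real)"
  by (simp add: Beta_def Gamma_real_pos)

text \<open>Two steps of the recursion in the first argument. The factor is the mean of the square
  of a Beta variable with parameters \<open>a\<close> and \<open>b\<close>.\<close>

lemma Beta_plus2_left:
  fixes a b :: real
  assumes "0 < a" "0 < b"
  shows "Beta (a + 2) b = a * (a + 1) / ((a + b) * (a + b + 1)) * Beta a b"
proof -
  have "a \<notin> \<int>\<^sub>\<le>\<^sub>0" "a + 1 \<notin> \<int>\<^sub>\<le>\<^sub>0"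
    using assms by (auto elim!: nonpos_Ints_cases)
  then have "(a + b) * Beta (a + 1) b = a * Beta a b"
    "(a + 1 + b) * Beta (a + 2) b = (a + 1) * Beta (a + 1) b"
    using Beta_plus1_left[of a b] Beta_plus1_left[of "a + 1" b] by (simp_all add: add.assoc)
  then have "Beta (a + 1) b = a * Beta a b / (a + b)"
    "Beta (a + 2) b = (a + 1) * Beta (a + 1) b / (a + b + 1)"
    using assms by (simp_all add: field_simps)
  then show ?thesis by simp
qed

lemma has_integral_Beta_nat:
  fixes a :: real and l :: nat
  assumes "0 < a"
  shows "((\<lambda>s. s powr (a - 1) * (1 - s) ^ l) has_integral Beta a (real l + 1)) {0..1}"
\<comment> \<open>At \<open>s = 1\<close> with \<open>l = 0\<close> the two forms differ:
  \<open>0 ^ 0 = 1\<close> but \<open>0 powr 0 = 0\<close>.\<close>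
proof (rule has_integral_spike_finite[of "{1}"])
  show "((\<lambda>s. s powr (a - 1) * (1 - s) powr (real l + 1 - 1)) has_integral Beta a (real l + 1)) {0..1}"
    using assms by (intro has_integral_Beta_real) auto
qed (auto simp: powr_realpow)

section \<open>Beta-mean representation and moments\<close>

text \<open>The constant in \<open>wendland_psi\<close> is
  \<open>2 powr (k - 1) * Gamma k / Beta (2 * k) (l + 1)\<close>, so multiplying by the Beta value
  leaves exactly the factor that cancels the prefactor of \<open>wendland_phi\<close>. With
  \<open>k > 1\<close> the exponent \<open>k - 1\<close> is positive and the truncated integrand is
  continuous.\<close>

lemma wendland_psi_has_integral:
  fixes k \<alpha> y :: real and l :: nat
  assumes "1 < k" "0 < \<alpha>" "0 \<le> y"
  defines "r \<equiv> y / wendland_delta l k \<alpha>"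
  shows "((\<lambda>s. s powr (2 * k - 1) * (1 - s) ^ l * max 0 (1 - (r / s)\<^sup>2) powr (k - 1))
    has_integral wendland_psi l k \<alpha> y * Beta (2 * k) (real l + 1)) {0..1}"
proof -
  \<comment> \<open>Truncating with \<open>max 0\<close> lets the integral run over the fixed
    interval from 0 to 1; it also covers \<open>r > 1\<close>, where \<open>h\<close> vanishes on
    the whole interval.\<close>
  define h where "h = (\<lambda>s. s * (1 - s) ^ l * max 0 (s\<^sup>2 - r\<^sup>2) powr (k - 1))"
  have \<delta>: "0 < wendland_delta l k \<alpha>"
    using assms by (simp add: wendland_delta_def Gamma_real_pos)
  have r: "0 \<le> r" using \<delta> assms by (simp add: r_def)
  have cont: "continuous_on A h" for A
    unfolding h_def using assms(1)
    by (intro continuous_on_mult continuous_on_powr' continuous_intros) auto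
  have zero: "h s = 0" if "0 \<le> s" "s \<le> r" for s
    using that power_mono[of s r 2] by (simp add: h_def)
  have "integral {0..1} h = wendland_psi l k \<alpha> y * Beta (2 * k) (real l + 1)"
  proof (cases "r \<le> 1")
    case True
    have "integral {0..1} h = integral {0..r} h + integral {r..1} h"
      using True r by (intro Henstock_Kurzweil_Integration.integral_combine[symmetric]
        integrable_continuous_interval cont) auto
    also have "integral {0..r} h = integral {0..r} (\<lambda>_. 0)"
      by (rule integral_cong) (simp add: zero)
    also have "integral {r..1} h = integral {r..1} (\<lambda>s. s * (1 - s) ^ l * (s\<^sup>2 - r\<^sup>2) powr (k - 1))"
      using r by (intro integral_cong) (auto simp: h_def max_def)
    finally have "integral {0..1} h = integral {r..1} (\<lambda>s. s * (1 - s) ^ l * (s\<^sup>2 - r\<^sup>2) powr (k - 1))"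
      by simp
    moreover have "0 < Gamma k" using assms(1) by (intro Gamma_real_pos) simp
    ultimately have "integral {0..1} h = wendland_phi l k r * (Gamma k * 2 powr (k - 1))"
      using True by (simp add: wendland_phi_def)
    moreover have "wendland_psi l k \<alpha> y * Beta (2 * k) (real l + 1)
        = wendland_phi l k r * (Gamma k * 2 powr (k - 1))"
    proof -
      have nz: "Gamma (real l + 1) \<noteq> 0" "Gamma (2 * k) \<noteq> 0" "Gamma (real l + 2 * k + 1) \<noteq> 0"
        using assms by (auto intro!: less_imp_neq[THEN not_sym] Gamma_real_pos)
      have le: "y \<le> wendland_delta l k \<alpha>"
        using True \<delta> by (simp add: r_def field_simps)
      have eq: "2 * k + (real l + 1) = real l + 2 * k + 1" by simp
      show ?thesis
        unfolding wendland_psi_def Beta_def r_def eq using nz le by (simp add: field_simps)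
    qed
    ultimately show ?thesis by simp
  next
    case False
    have "integral {0..1} h = integral {0..1} (\<lambda>_::real. 0)"
      by (rule integral_cong) (use False in \<open>auto intro!: zero\<close>)
    moreover have "\<not> y \<le> wendland_delta l k \<alpha>"
      using False \<delta> by (simp add: r_def field_simps)
    ultimately show ?thesis by (simp add: wendland_psi_def)
  qed
  then have "(h has_integral wendland_psi l k \<alpha> y * Beta (2 * k) (real l + 1)) {0..1}"
    using integrable_integral[OF integrable_continuous_interval[OF cont]] by metis
  then show ?thesis
  \<comment> \<open>Pulling \<open>s^2\<close> out of the power divides by \<open>s\<close>, so the
    endpoint 0 is set aside.\<close>
  proof (rule has_integral_spike_finite[of "{0}", rotated 2])
    fix s :: real assume "s \<in> {0..1} - {0}"
    then have s: "0 < s" by auto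
    have "max 0 (s\<^sup>2 - r\<^sup>2) = s\<^sup>2 * max 0 (1 - (r / s)\<^sup>2)"
      using s by (auto simp: max_def field_simps power2_eq_square)
    moreover have "s powr (2 * k - 1) = s * s\<^sup>2 powr (k - 1)"
      using s by (simp add: powr_powr powr_mult_base flip: powr_numeral)
    ultimately show "s powr (2 * k - 1) * (1 - s) ^ l * max 0 (1 - (r / s)\<^sup>2) powr (k - 1) = h s"
      by (simp add: h_def powr_mult)
  qed simp
qed

text \<open>The mean of \<open>(S\<^sup>2 / c - 1)\<^sup>2\<close> for a Beta-distributed \<open>S\<close> with parameters \<open>2k\<close> and \<open>l + 1\<close>.\<close>

definition wendland_var :: "nat \<Rightarrow> real \<Rightarrow> real \<Rightarrow> real" where
  "wendland_var l k c =
     (2 * k) * (2 * k + 1) * (2 * k + 2) * (2 * k + 3)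
       / ((real l + 2 * k + 1) * (real l + 2 * k + 2) * (real l + 2 * k + 3) * (real l + 2 * k + 4)) / c\<^sup>2
     - 2 * ((2 * k) * (2 * k + 1) / ((real l + 2 * k + 1) * (real l + 2 * k + 2))) / c + 1"

text \<open>Expanding the square gives the powers \<open>s^4\<close>, \<open>s^2\<close> and 1,
  which shift the first Beta parameter by 4, 2 and 0.\<close>

lemma Beta_second_moment:
  fixes k c :: real and l :: nat
  assumes "0 < k" "c \<noteq> 0"
  shows "((\<lambda>s. s powr (2 * k - 1) * (1 - s) ^ l * (s\<^sup>2 / c - 1)\<^sup>2)
    has_integral wendland_var l k c * Beta (2 * k) (real l + 1)) {0..1}"
proof -
  define B where "B = Beta (2 * k) (real l + 1)"
  define g where "g = (\<lambda>a s. s powr (a - 1) * (1 - s) ^ l :: real)"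
  have int: "(g a has_integral Beta a (real l + 1)) {0..1}" if "0 < a" for a
    unfolding g_def using has_integral_Beta_nat[OF that] .
  have "((\<lambda>s. g (2 * k + 4) s / c\<^sup>2 - 2 / c * g (2 * k + 2) s + g (2 * k) s) has_integral
      Beta (2 * k + 4) (real l + 1) / c\<^sup>2 - 2 / c * Beta (2 * k + 2) (real l + 1) + B) {0..1}"
    unfolding B_def using assms
    by (intro has_integral_add has_integral_diff has_integral_divide has_integral_mult_right int) auto
  moreover have "Beta (2 * k + 4) (real l + 1) / c\<^sup>2 - 2 / c * Beta (2 * k + 2) (real l + 1) + B
      = wendland_var l k c * B"
  proof -
    \<comment> \<open>\<open>P\<close> is the mean of \<open>S^2\<close> and \<open>Q * P\<close>
      that of \<open>S^4\<close>: the factors for the shifts from \<open>2 * k\<close> to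
      \<open>2 * k + 2\<close> and on to \<open>2 * k + 4\<close>.\<close>
    define P where "P = (2 * k) * (2 * k + 1) / ((real l + 2 * k + 1) * (real l + 2 * k + 2))"
    define Q where "Q = (2 * k + 2) * (2 * k + 3) / ((real l + 2 * k + 3) * (real l + 2 * k + 4))"
    have 2: "Beta (2 * k + 2) (real l + 1) = P * B"
      using Beta_plus2_left[of "2 * k" "real l + 1"] assms by (simp add: B_def P_def add_ac)
    have 4: "Beta (2 * k + 4) (real l + 1) = Q * (P * B)"
      unfolding 2[symmetric]
      using Beta_plus2_left[of "2 * k + 2" "real l + 1"] assms by (simp add: Q_def add_ac)
    have var: "wendland_var l k c = Q * P / c\<^sup>2 - 2 * P / c + 1"
      unfolding wendland_var_def P_def Q_def by (simp add: mult_ac)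
    show ?thesis
      unfolding 2 4 var by (simp add: algebra_simps)
  qed
  ultimately have "((\<lambda>s. g (2 * k + 4) s / c\<^sup>2 - 2 / c * g (2 * k + 2) s + g (2 * k) s)
      has_integral wendland_var l k c * B) {0..1}" by simp
  then show ?thesis
    unfolding B_def
  proof (rule has_integral_spike_finite[of "{0}", rotated 2])
    fix s :: real assume "s \<in> {0..1} - {0}"
    then have s: "0 < s" by auto
    have "s powr (2 * k + 4 - 1) = s powr (2 * k - 1) * s ^ 4"
      "s powr (2 * k + 2 - 1) = s powr (2 * k - 1) * s\<^sup>2"
      using s by (simp_all flip: powr_numeral powr_add add: algebra_simps)
    then show "s powr (2 * k - 1) * (1 - s) ^ l * (s\<^sup>2 / c - 1)\<^sup>2
        = g (2 * k + 4) s / c\<^sup>2 - 2 / c * g (2 * k + 2) s + g (2 * k) s"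
      using assms by (simp add: g_def field_simps power2_eq_square power4_eq_xxxx)
  qed simp
qed

section \<open>Error bound independent of \<open>y\<close>\<close>

text \<open>The integrands are compared pointwise against the Beta weight and the result is divided
  by its mass \<open>B\<close>. The free parameter \<open>e\<close> turns the first absolute moment
  of \<open>s^2 / c - 1\<close> into the second moment, which is explicit.\<close>

lemma abs_wendland_psi_minus_gaussian_le:
  fixes k \<alpha> y e :: real and l :: nat
  assumes k: "2 \<le> k" and "0 < \<alpha>" "0 \<le> y" "0 < e"
  defines "c \<equiv> (k - 1) / ((wendland_delta l k \<alpha>)\<^sup>2 * \<alpha>)"
  shows "\<bar>wendland_psi l k \<alpha> y - exp (- \<alpha> * y\<^sup>2)\<bar> \<le> 2 / (k - 1) + e / 2 + wendland_var l k c / (2 * e)"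
proof -
  define \<delta> where "\<delta> = wendland_delta l k \<alpha>"
  define r where "r = y / \<delta>"
  define B where "B = Beta (2 * k) (real l + 1)"
  define w where "w = (\<lambda>s. s powr (2 * k - 1) * (1 - s) ^ l :: real)"
  have \<delta>: "0 < \<delta>"
    using assms by (simp add: \<delta>_def wendland_delta_def Gamma_real_pos)
  have c: "0 < c" using \<delta> assms by (simp add: c_def \<delta>_def)
  have B: "0 < B" using assms by (simp add: B_def Beta_real_pos)
  have 1: "((\<lambda>s. w s * max 0 (1 - (r / s)\<^sup>2) powr (k - 1) - exp (- \<alpha> * y\<^sup>2) * w s) has_integral
      wendland_psi l k \<alpha> y * B - exp (- \<alpha> * y\<^sup>2) * B) {0..1}"
    unfolding w_def B_def r_def \<delta>_def using assms
    by (intro has_integral_diff has_integral_mult_right wendland_psi_has_integral has_integral_Beta_nat) auto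
  have 2: "((\<lambda>s. (2 / (k - 1) + e / 2) * w s + w s * (s\<^sup>2 / c - 1)\<^sup>2 / (2 * e)) has_integral
      (2 / (k - 1) + e / 2) * B + wendland_var l k c * B / (2 * e)) {0..1}"
    unfolding w_def B_def using assms c
    by (intro has_integral_add has_integral_divide has_integral_mult_right Beta_second_moment has_integral_Beta_nat) auto
  have bound: "\<bar>w s * max 0 (1 - (r / s)\<^sup>2) powr (k - 1) - exp (- \<alpha> * y\<^sup>2) * w s\<bar>
      \<le> (2 / (k - 1) + e / 2) * w s + w s * (s\<^sup>2 / c - 1)\<^sup>2 / (2 * e)" if s01: "s \<in> {0..1}" for s
  \<comment> \<open>At \<open>s = 0\<close> the quotient \<open>r / s\<close> carries no meaning,
    but there the weight \<open>w\<close> is 0.\<close>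
  proof (cases "s = 0")
    case False
    then have s: "0 < s" "s \<le> 1" using s01 by auto
    \<comment> \<open>This identity dictates the choice of \<open>c\<close>: the Gaussian exponent
      appears divided by \<open>s^2 / c\<close>.\<close>
    have "(k - 1) * (r / s)\<^sup>2 = (\<alpha> * y\<^sup>2) / (s\<^sup>2 / c)"
      using \<delta> s assms(2) by (simp add: c_def r_def power_divide field_simps flip: \<delta>_def)
    then have "\<bar>max 0 (1 - (r / s)\<^sup>2) powr (k - 1) - exp (- ((\<alpha> * y\<^sup>2) / (s\<^sup>2 / c)))\<bar> \<le> 2 / (k - 1)"
      using abs_powr_minus_exp_le[of "k - 1" "(r / s)\<^sup>2"] k by simp
    moreover have "\<bar>exp (- ((\<alpha> * y\<^sup>2) / (s\<^sup>2 / c))) - exp (- (\<alpha> * y\<^sup>2))\<bar> \<le> \<bar>s\<^sup>2 / c - 1\<bar>"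
      using assms(2,3) c s by (intro abs_exp_minus_divide_diff_le) auto
    moreover have "\<bar>z\<bar> \<le> e / 2 + z\<^sup>2 / (2 * e)" for z
      using zero_le_power2[of "\<bar>z\<bar> - e"] \<open>0 < e\<close>
      by (simp add: field_simps power2_eq_square)
    ultimately have "\<bar>max 0 (1 - (r / s)\<^sup>2) powr (k - 1) - exp (- (\<alpha> * y\<^sup>2))\<bar>
        \<le> 2 / (k - 1) + e / 2 + (s\<^sup>2 / c - 1)\<^sup>2 / (2 * e)"
      by (smt (verit))
    moreover have "0 \<le> w s" using s by (simp add: w_def)
    ultimately have "w s * \<bar>max 0 (1 - (r / s)\<^sup>2) powr (k - 1) - exp (- (\<alpha> * y\<^sup>2))\<bar>
        \<le> w s * (2 / (k - 1) + e / 2 + (s\<^sup>2 / c - 1)\<^sup>2 / (2 * e))"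
      by (rule mult_left_mono)
    moreover have "w s * \<bar>z - x\<bar> = \<bar>w s * z - x * w s\<bar>" for z x
      using \<open>0 \<le> w s\<close> abs_mult[of "w s" "z - x"] by (simp add: algebra_simps)
    ultimately show ?thesis
      by (simp add: algebra_simps)
  qed (simp add: w_def)
  have "norm (wendland_psi l k \<alpha> y * B - exp (- \<alpha> * y\<^sup>2) * B)
      \<le> (2 / (k - 1) + e / 2) * B + wendland_var l k c * B / (2 * e)"
    unfolding integral_unique[OF 1, symmetric] integral_unique[OF 2, symmetric]
    using 1 2 bound by (intro integral_norm_bound_integral) auto
  also have "wendland_psi l k \<alpha> y * B - exp (- \<alpha> * y\<^sup>2) * B
      = (wendland_psi l k \<alpha> y - exp (- \<alpha> * y\<^sup>2)) * B"
    by (rule left_diff_distrib[symmetric])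
  also have "(2 / (k - 1) + e / 2) * B + wendland_var l k c * B / (2 * e)
      = (2 / (k - 1) + e / 2 + wendland_var l k c / (2 * e)) * B"
    by (simp add: distrib_right)
  finally have "\<bar>wendland_psi l k \<alpha> y - exp (- \<alpha> * y\<^sup>2)\<bar> * B
      \<le> (2 / (k - 1) + e / 2 + wendland_var l k c / (2 * e)) * B"
    using B by (simp add: abs_mult)
  then show ?thesis using B by simp
qed

section \<open>Limits along \<open>k = n / 2\<close>\<close>

text \<open>With \<open>2 * k = n\<close> and \<open>l\<close> close to \<open>n / 2\<close>, each
  factor of the moments tends to \<open>1 / (3/2) = 2/3\<close>. Since \<open>c\<close> tends to
  \<open>(2/3)^2\<close>, the limit is \<open>1 - 2 + 1\<close>.\<close>

lemma wendland_var_tendsto_0: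
  fixes l :: "nat \<Rightarrow> nat" and c :: "nat \<Rightarrow> real"
  assumes l: "(\<lambda>n. real (l n) / real n) \<longlonglongrightarrow> 1/2" and c: "c \<longlonglongrightarrow> 4/9"
  shows "(\<lambda>n. wendland_var (l n) (real n / 2) (c n)) \<longlonglongrightarrow> 0"
proof -
  have factor: "(\<lambda>n. (real n + a) / (real (l n) + real n + b)) \<longlonglongrightarrow> 2/3" for a b
  proof (rule Lim_transform_eventually)
    have "(\<lambda>n. (1 + a / real n) / (real (l n) / real n + 1 + b / real n)) \<longlonglongrightarrow> (1 + 0) / (1/2 + 1 + 0)"
      by (intro tendsto_intros l lim_const_over_n) auto
    then show "(\<lambda>n. (1 + a / real n) / (real (l n) / real n + 1 + b / real n)) \<longlonglongrightarrow> 2/3"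
      by simp
    show "\<forall>\<^sub>F n in sequentially. (1 + a / real n) / (real (l n) / real n + 1 + b / real n)
        = (real n + a) / (real (l n) + real n + b)"
      using eventually_gt_at_top[of 0]
    proof eventually_elim
      case (elim n)
      then have "1 + a / real n = (real n + a) / real n"
        "real (l n) / real n + 1 + b / real n = (real (l n) + real n + b) / real n"
        by (simp_all add: field_simps)
      then show ?case using elim by simp
    qed
  qed
  let ?f = "\<lambda>a b n. (real n + a) / (real (l n) + real n + b)"
  have "(\<lambda>n. ?f 0 1 n * ?f 1 2 n * ?f 2 3 n * ?f 3 4 n / (c n)\<^sup>2 - 2 * (?f 0 1 n * ?f 1 2 n) / c n + 1)
      \<longlonglongrightarrow> (2/3) * (2/3) * (2/3) * (2/3) / (4/9)\<^sup>2 - 2 * ((2/3) * (2/3)) / (4/9) + 1"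
    by (intro tendsto_intros factor c) auto
  then show ?thesis
    by (simp add: wendland_var_def power2_eq_square)
qed

text \<open>For fixed \<open>d\<close> the floor and the shift by 1 change \<open>n / 2\<close> only
  by a bounded amount.\<close>

lemma wendland_ell_over_tendsto: "(\<lambda>n. real (wendland_ell d (real n / 2)) / real n) \<longlonglongrightarrow> 1/2"
proof (rule tendsto_sandwich)
  have "(\<lambda>n. 1/2 + 0 / real n) \<longlonglongrightarrow> 1/2 + 0"
    "(\<lambda>n. 1/2 + (real d / 2 + 1) / real n) \<longlonglongrightarrow> 1/2 + 0"
    by (intro tendsto_intros lim_const_over_n)+
  then show "(\<lambda>n. 1/2 + 0 / real n) \<longlonglongrightarrow> 1/2" "(\<lambda>n. 1/2 + (real d / 2 + 1) / real n) \<longlonglongrightarrow> 1/2"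
    by simp_all
  have bounds: "real n / 2 \<le> real (wendland_ell d (real n / 2))"
    "real (wendland_ell d (real n / 2)) \<le> real n / 2 + (real d / 2 + 1)" for n
  proof -
    have "real (nat \<lfloor>real d / 2 + real n / 2\<rfloor>) = real_of_int \<lfloor>real d / 2 + real n / 2\<rfloor>"
      by simp
    then show "real n / 2 \<le> real (wendland_ell d (real n / 2))"
      "real (wendland_ell d (real n / 2)) \<le> real n / 2 + (real d / 2 + 1)"
      unfolding wendland_ell_def of_nat_add by linarith+
  qed
  show "\<forall>\<^sub>F n in sequentially. 1/2 + 0 / real n \<le> real (wendland_ell d (real n / 2)) / real n"
    using eventually_gt_at_top[of 0]
    by eventually_elim (use bounds in \<open>simp add: field_simps\<close>)
  show "\<forall>\<^sub>F n in sequentially. real (wendland_ell d (real n / 2)) / real n \<le> 1/2 + (real d / 2 + 1) / real n"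
    using eventually_gt_at_top[of 0]
  proof eventually_elim
    case (elim n)
    then show ?case
      using divide_right_mono[OF bounds(2)[of n], of "real n"] by (simp add: add_divide_distrib)
  qed
qed

text \<open>The parameter \<open>\<alpha>\<close> cancels. With \<open>M = l + n + 1\<close> and
  \<open>G\<close> the squared Gamma ratio, the scale is \<open>4 * (n / 2 - 1) * G / M^2\<close>.
  Here \<open>G\<close> grows like \<open>n / 2\<close> and \<open>M\<close> like
  \<open>3 * n / 2\<close>, whence \<open>4/9\<close>.\<close>

lemma wendland_scale_tendsto:
  fixes l :: "nat \<Rightarrow> nat" and \<alpha> :: real
  assumes l: "(\<lambda>n. real (l n) / real n) \<longlonglongrightarrow> 1/2" and "0 < \<alpha>"
  shows "(\<lambda>n. (real n / 2 - 1) / ((wendland_delta (l n) (real n / 2) \<alpha>)\<^sup>2 * \<alpha>)) \<longlonglongrightarrow> 4/9"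
proof (rule Lim_transform_eventually)
  let ?G = "\<lambda>n. (Gamma (real n / 2 + 1) / Gamma (real n / 2 + 1/2))\<^sup>2"
  have G: "(\<lambda>n. ?G n / real n) \<longlonglongrightarrow> 1/2"
  proof (rule tendsto_sandwich)
    show "\<forall>\<^sub>F n in sequentially. 1/2 \<le> ?G n / real n"
      using eventually_gt_at_top[of 0]
    proof eventually_elim
      case (elim n)
      then show ?case
        using divide_right_mono[OF Gamma_half_ratio_bounds(1)[of "real n / 2"], of "real n"] by simp
    qed
    show "\<forall>\<^sub>F n in sequentially. ?G n / real n \<le> 1/2 + (1/2) / real n"
      using eventually_gt_at_top[of 0]
    proof eventually_elim
      case (elim n)
      then show ?case
        using divide_right_mono[OF Gamma_half_ratio_bounds(2)[of "real n / 2"], of "real n"]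
        by (simp add: add_divide_distrib)
    qed
    have "(\<lambda>n. 1/2 + (1/2) / real n) \<longlonglongrightarrow> 1/2 + 0"
      by (intro tendsto_intros lim_const_over_n)
    then show "(\<lambda>n. 1/2 + (1/2) / real n) \<longlonglongrightarrow> 1/2" by simp
  qed simp
  have "(\<lambda>n. (1/2 - 1 / real n) * (?G n / real n) * 4 / (real (l n) / real n + 1 + 1 / real n)\<^sup>2)
      \<longlonglongrightarrow> (1/2 - 0) * (1/2) * 4 / (1/2 + 1 + 0)\<^sup>2"
    by (intro tendsto_intros l lim_const_over_n G) auto
  then show "(\<lambda>n. (1/2 - 1 / real n) * (?G n / real n) * 4 / (real (l n) / real n + 1 + 1 / real n)\<^sup>2)
      \<longlonglongrightarrow> 4/9"
    by (simp add: power2_eq_square)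
  show "\<forall>\<^sub>F n in sequentially.
      (1/2 - 1 / real n) * (?G n / real n) * 4 / (real (l n) / real n + 1 + 1 / real n)\<^sup>2
      = (real n / 2 - 1) / ((wendland_delta (l n) (real n / 2) \<alpha>)\<^sup>2 * \<alpha>)"
    using eventually_gt_at_top[of 0]
  proof eventually_elim
    case (elim n)
    define M where "M = real (l n) + real n + 1"
    define x where "x = real n / 2 - 1"
    have pos: "0 < Gamma (real n / 2 + 1)" "0 < Gamma (real n / 2 + 1/2)" "0 < M"
      by (auto intro!: Gamma_real_pos simp: M_def)
    have L: "real (l n) / real n + 1 + 1 / real n = M / real n"
      and N: "1/2 - 1 / real n = x / real n"
      using elim by (simp_all add: field_simps M_def x_def)
    have "wendland_delta (l n) (real n / 2) \<alpha>
        = M * Gamma (real n / 2 + 1/2) / (2 * sqrt \<alpha> * Gamma (real n / 2 + 1))"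
      by (simp add: wendland_delta_def M_def)
    then have D: "(wendland_delta (l n) (real n / 2) \<alpha>)\<^sup>2 * \<alpha> = M\<^sup>2 / (4 * ?G n)"
      using assms(2) pos by (simp add: power_divide power_mult_distrib)
    have "x / real n * (?G n / real n) * 4 / (M / real n)\<^sup>2 = x / (M\<^sup>2 / (4 * ?G n))"
      using elim by (simp add: power_divide power2_eq_square mult_ac)
    then show ?case
      unfolding L N D x_def[symmetric] .
  qed
qed

theorem theorem4p2:
  fixes d :: nat and \<alpha> :: real
  assumes "d \<ge> 1" and "\<alpha> > 0"
  shows "uniform_limit {0..}
           (\<lambda>n y. wendland_psi (wendland_ell d (real n / 2)) (real n / 2) \<alpha> y)
           (\<lambda>y. exp (- \<alpha> * y\<^sup>2)) sequentially"
proof (rule uniform_limitI)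
  fix e :: real assume e: "0 < e"
  define l where "l = (\<lambda>n. wendland_ell d (real n / 2))"
  define c where "c = (\<lambda>n. (real n / 2 - 1) / ((wendland_delta (l n) (real n / 2) \<alpha>)\<^sup>2 * \<alpha>))"
  have l: "(\<lambda>n. real (l n) / real n) \<longlonglongrightarrow> 1/2"
    unfolding l_def by (rule wendland_ell_over_tendsto)
  have "c \<longlonglongrightarrow> 4/9"
    unfolding c_def using l assms(2) by (rule wendland_scale_tendsto)
  \<comment> \<open>The tolerance \<open>e\<close> doubles as the free parameter of the error bound:
    that bound then tends to \<open>e / 2\<close>, which is below \<open>e\<close>.\<close>
  then have "(\<lambda>n. wendland_var (l n) (real n / 2) (c n) / (2 * e)) \<longlonglongrightarrow> 0 / (2 * e)"
    using e by (intro tendsto_divide wendland_var_tendsto_0 l) auto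
  then have "(\<lambda>n. 8 / real n + e / 2 + wendland_var (l n) (real n / 2) (c n) / (2 * e))
      \<longlonglongrightarrow> 0 + e / 2 + 0 / (2 * e)"
    by (intro tendsto_add tendsto_const lim_const_over_n)
  then have "\<forall>\<^sub>F n in sequentially.
      8 / real n + e / 2 + wendland_var (l n) (real n / 2) (c n) / (2 * e) < e"
    by (rule order_tendstoD) (use e in simp)
  then show "\<forall>\<^sub>F n in sequentially. \<forall>y\<in>{0..}.
      dist (wendland_psi (wendland_ell d (real n / 2)) (real n / 2) \<alpha> y) (exp (- \<alpha> * y\<^sup>2)) < e"
    \<comment> \<open>\<open>n \<ge> 4\<close> means \<open>k \<ge> 2\<close>, as the error bound
      requires, and it is also exactly when \<open>2 / (n / 2 - 1) \<le> 8 / n\<close> for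
      \<open>n > 2\<close>.\<close>
    using eventually_ge_at_top[of 4]
  proof eventually_elim
    case (elim n)
    show ?case
    proof
      fix y :: real assume "y \<in> {0..}"
      then have "dist (wendland_psi (l n) (real n / 2) \<alpha> y) (exp (- \<alpha> * y\<^sup>2))
          \<le> 2 / (real n / 2 - 1) + e / 2 + wendland_var (l n) (real n / 2) (c n) / (2 * e)"
        using abs_wendland_psi_minus_gaussian_le[of "real n / 2" \<alpha> y e "l n"] elim(2) assms(2) e
        by (simp add: dist_real_def c_def)
      moreover have "2 / (real n / 2 - 1) \<le> 8 / real n"
        using elim(2) by (simp add: field_simps)
      ultimately show "dist (wendland_psi (wendland_ell d (real n / 2)) (real n / 2) \<alpha> y) (exp (- \<alpha> * y\<^sup>2)) < e"
        using elim(1) by (simp add: l_def)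
    qed
  qed
qed

end
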